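(* Let $a,b$ be positive integers with $a\geq 2b$, and let $G$ be a simple graph. If $G$ is $a\!:\!b$-colourable, then: (1) $\mathbb{K}_1\text{-cover}_{\mathrm{f}}(G)\leq \frac{a}{b}$; (2) $\displaystyle \mathbb{K}_k\text{-cover}_{\mathrm{f}}(G)\leq \frac{\binom{a}{b}}{\max\left\{\binom{(k+1)b-1}{b},\ \binom{a}{b}-\binom{a-k}{b}\right\}}$ for every integer $k$ with $1<k<\omega(G)$; and (3) $\mathbb{K}_{\omega(G)}\text{-cover}_{\mathrm{f}}(G)=1$.
   Context: All graphs are finite and simple (no loops or multiple edges), with non-empty vertex set. A graph $G$ is $a\!:\!b$-colourable (has an $a\!:\!b$-colouring) if each vertex can be assigned a set of $b$ colours taken from a palette of $a$ colours so that adjacent vertices are given disjoint sets of colours. The clique number $\omega(G)$ is the largest number of vertices of $G$ inducing a complete subgraph. For an integer $k\geq 1$, $\mathbb{K}_k$ is the class of graphs not containing a $(k+1)$-clique. $\mathbb{K}_k(G)$ denotes the set of induced subgraphs of $G$ belonging to $\mathbb{K}_k$, and for $v\in V(G)$, $\mathbb{K}_k(G,v)$ denotes the set of those elements of $\mathbb{K}_k(G)$ that contain $v$. A fractional $\mathbb{K}_k$-cover of $G$ is a function $f:\mathbb{K}_k(G)\to[0,1]$ such that $\sum_{H\in\mathbb{K}_k(G,v)}f(H)\geq 1$ for every $v\in V(G)$. Its weight is $\sum_{H\in\mathbb{K}_k(G)}f(H)$. The fractional $\mathbb{K}_k$-cover number of $G$, denoted $\mathbb{K}_k\text{-cover}_{\mathrm{f}}(G)$,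 is the minimum weight over all fractional $\mathbb{K}_k$-covers of $G$. *)

theory Defs
  imports "HOL-Analysis.Analysis" "Graph_Theory.Kuratowski"
begin

text \<open>
  A finite simple graph is a \<^term>\<open>G\<close> with \<^prop>\<open>graph G\<close>: a finite symmetric digraph without loops
  or parallel arcs, an undirected edge being a pair of opposite arcs. The locale admits the
  null graph, so non-emptiness of the vertex set is stated separately where it is needed.
\<close>

definition ab_colourable :: "nat \<Rightarrow> nat \<Rightarrow> ('a, 'b) pre_digraph \<Rightarrow> bool" where
  "ab_colourable a b G \<longleftrightarrow>
    (\<exists>c :: 'a \<Rightarrow> nat set.
      (\<forall>v \<in> verts G. c v \<subseteq> {..<a} \<and> card (c v) = b) \<and>
      (\<forall>u v. u \<rightarrow>\<^bsub>G\<^esub> v \<longrightarrow> c u \<inter> c v = {}))"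

definition contains_clique :: "nat \<Rightarrow> ('a, 'b) pre_digraph \<Rightarrow> bool" where
  "contains_clique n G \<longleftrightarrow> (\<exists>H. subgraph H G \<and> complete_digraph n H)"

definition clique_number :: "('a, 'b) pre_digraph \<Rightarrow> nat" where
  "clique_number G = Max {card (verts H) | H.
     induced_subgraph H G \<and> complete_digraph (card (verts H)) H}"

definition in_K :: "nat \<Rightarrow> ('a, 'b) pre_digraph \<Rightarrow> bool" where
  "in_K k G \<longleftrightarrow> \<not> contains_clique (k + 1) G"

definition K_subgraphs :: "nat \<Rightarrow> ('a, 'b) pre_digraph \<Rightarrow> ('a, 'b) pre_digraph set" where
  "K_subgraphs k G = {H. induced_subgraph H G \<and> verts H \<noteq> {} \<and> in_K k H}"

definition K_subgraphs_at ::
    "nat \<Rightarrow> ('a, 'b) pre_digraph \<Rightarrow> 'a \<Rightarrow> ('a, 'b) pre_digraph set" where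
  "K_subgraphs_at k G v = {H \<in> K_subgraphs k G. v \<in> verts H}"

definition fractional_K_cover ::
    "nat \<Rightarrow> ('a, 'b) pre_digraph \<Rightarrow> (('a, 'b) pre_digraph \<Rightarrow> real) \<Rightarrow> bool" where
  "fractional_K_cover k G f \<longleftrightarrow>
    f \<in> K_subgraphs k G \<rightarrow> {0..1} \<and>
    (\<forall>v \<in> verts G. (\<Sum>H \<in> K_subgraphs_at k G v. f H) \<ge> 1)"

definition K_cover_weight ::
    "nat \<Rightarrow> ('a, 'b) pre_digraph \<Rightarrow> (('a, 'b) pre_digraph \<Rightarrow> real) \<Rightarrow> real" where
  "K_cover_weight k G f = (\<Sum>H \<in> K_subgraphs k G. f H)"

text \<open>
  The \<^const>\<open>Least\<close> below denotes a genuine minimum whenever \<^prop>\<open>graph G\<close> and \<^prop>\<open>k \<ge> 1\<close>;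
  see the lemmas \<open>fractional_K_cover_number_attained\<close> and \<open>fractional_K_cover_number_le\<close>.
\<close>

definition fractional_K_cover_number :: "nat \<Rightarrow> ('a, 'b) pre_digraph \<Rightarrow> real" where
  "fractional_K_cover_number k G =
    (LEAST w. \<exists>f. fractional_K_cover k G f \<and> K_cover_weight k G f = w)"

lemma finite_induced_subgraphs:
  assumes "graph G"
  shows "finite {H. induced_subgraph H G}"
proof -
  interpret graph G by fact
  have "{H. induced_subgraph H G} \<subseteq> (\<lambda>S. G \<restriction> S) ` Pow (verts G)"
  proof
    fix H assume "H \<in> {H. induced_subgraph H G}"
    then have H: "H = G \<restriction> verts H" "verts H \<subseteq> verts G"
      by (auto simp: induced_subgraph_def subgraph_def compatible_def induce_subgraph_def
          intro!: pre_digraph.equality)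
    then show "H \<in> (\<lambda>S. G \<restriction> S) ` Pow (verts G)" by blast
  qed
  then show ?thesis by (rule finite_subset) simp
qed

lemma finite_K_subgraphs: "graph G \<Longrightarrow> finite (K_subgraphs k G)"
  by (rule finite_subset[OF _ finite_induced_subgraphs]) (auto simp: K_subgraphs_def)

lemma single_vertex_in_K_subgraphs_at:
  assumes "graph G" "k \<ge> 1" "v \<in> verts G"
  shows "G \<restriction> {v} \<in> K_subgraphs_at k G v"
proof -
  interpret graph G by fact
  have "in_K k (G \<restriction> {v})"
    unfolding in_K_def contains_clique_def
  proof
    assume "\<exists>H. subgraph H (G \<restriction> {v}) \<and> complete_digraph (k + 1) H"
    then obtain H where "subgraph H (G \<restriction> {v})" "complete_digraph (k + 1) H" by blast
    then have "verts H \<subseteq> {v}" "card (verts H) = k + 1"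
      by (simp_all add: subgraph_def complete_digraph_def)
    with card_mono[of "{v}" "verts H"] assms(2) show False by simp
  qed
  moreover have "induced_subgraph (G \<restriction> {v}) G"
    by (rule induced_induce) (use assms in auto)
  ultimately show ?thesis
    by (simp add: K_subgraphs_at_def K_subgraphs_def)
qed

lemma fractional_K_cover_minimum_exists:
  assumes "graph G" "k \<ge> 1"
  shows "\<exists>f. fractional_K_cover k G f \<and>
    (\<forall>g. fractional_K_cover k G g \<longrightarrow> K_cover_weight k G f \<le> K_cover_weight k G g)"
proof -
  let ?K = "K_subgraphs k G"
  define B :: "('a, 'b) pre_digraph \<Rightarrow> real set" where "B H = (if H \<in> ?K then {0..1} else {0})" for H
  define C where "C = PiE UNIV B \<inter>
    (\<Inter>v \<in> verts G. {f. (\<Sum>H \<in> K_subgraphs_at k G v. f H) \<ge> 1})"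
  have "compact (B H)" for H by (simp add: B_def)
  then have "compactin (product_topology (\<lambda>_. euclidean) UNIV) (PiE UNIV B)"
    by (simp add: compactin_PiE)
  then have "compact (PiE UNIV B)"
    unfolding euclidean_product_topology compactin_euclidean_iff .
  moreover have "closed {f :: ('a, 'b) pre_digraph \<Rightarrow> real. (\<Sum>H \<in> K_subgraphs_at k G v. f H) \<ge> 1}" for v
    by (intro closed_Collect_le continuous_intros continuous_on_product_coordinates)
  ultimately have compact: "compact C"
    unfolding C_def by (intro compact_Int_closed closed_INT) auto
  have finK: "finite ?K" using assms(1) by (rule finite_K_subgraphs)
  have sub: "K_subgraphs_at k G v \<subseteq> ?K" for v by (auto simp: K_subgraphs_at_def)
  have "(\<lambda>H. if H \<in> ?K then 1 else 0) \<in> C"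
  proof -
    have "1 \<le> (\<Sum>H \<in> K_subgraphs_at k G v. if H \<in> ?K then 1 else (0 :: real))" if "v \<in> verts G" for v
    proof -
      have "(\<Sum>H \<in> K_subgraphs_at k G v. if H \<in> ?K then 1 else (0 :: real))
          = real (card (K_subgraphs_at k G v))"
        using sub[of v] by (subst sum.cong[OF refl, of _ _ "\<lambda>_. 1"]) auto
      moreover have "card (K_subgraphs_at k G v) > 0"
        using single_vertex_in_K_subgraphs_at[OF assms that] finite_subset[OF sub finK]
        by (auto simp: card_gt_0_iff)
      ultimately show ?thesis by simp
    qed
    then show ?thesis by (auto simp: C_def B_def)
  qed
  moreover have "continuous_on C (K_cover_weight k G)"
    unfolding K_cover_weight_def
    by (intro continuous_intros continuous_on_subset[OF continuous_on_product_coordinates]) auto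
  ultimately obtain f where f: "f \<in> C" "\<And>g. g \<in> C \<Longrightarrow> K_cover_weight k G f \<le> K_cover_weight k G g"
    using continuous_attains_inf[OF compact, of "K_cover_weight k G"] by blast
  have "fractional_K_cover k G f"
  proof -
    have "f \<in> ?K \<rightarrow> {0..1}"
    proof (rule funcsetI)
      fix H assume "H \<in> ?K"
      moreover have "f H \<in> B H" using f(1) by (simp add: C_def PiE_iff)
      ultimately show "f H \<in> {0..1}" by (simp add: B_def)
    qed
    then show ?thesis using f(1) by (auto simp: C_def fractional_K_cover_def)
  qed
  moreover have "K_cover_weight k G f \<le> K_cover_weight k G g" if g: "fractional_K_cover k G g" for g
  proof -
    define g' where "g' H = (if H \<in> ?K then g H else 0)" for H
    have "(\<Sum>H \<in> K_subgraphs_at k G v. g' H) = (\<Sum>H \<in> K_subgraphs_at k G v. g H)" for v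
      using sub[of v] by (intro sum.cong) (auto simp: g'_def)
    then have "g' \<in> C"
      using g by (auto simp: C_def B_def g'_def fractional_K_cover_def Pi_iff)
    moreover have "K_cover_weight k G g' = K_cover_weight k G g"
      by (simp add: K_cover_weight_def g'_def)
    ultimately show ?thesis using f(2) by metis
  qed
  ultimately show ?thesis by blast
qed

lemma fractional_K_cover_number_attained:
  assumes "graph G" "k \<ge> 1"
  obtains f where "fractional_K_cover k G f" "K_cover_weight k G f = fractional_K_cover_number k G"
proof -
  obtain f where f: "fractional_K_cover k G f"
    "\<And>g. fractional_K_cover k G g \<Longrightarrow> K_cover_weight k G f \<le> K_cover_weight k G g"
    using fractional_K_cover_minimum_exists[OF assms] by blast
  then have "fractional_K_cover_number k G = K_cover_weight k G f"
    unfolding fractional_K_cover_number_def by (intro Least_equality) auto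
  with f that show ?thesis by simp
qed

lemma fractional_K_cover_number_le:
  assumes "graph G" "k \<ge> 1" "fractional_K_cover k G g"
  shows "fractional_K_cover_number k G \<le> K_cover_weight k G g"
proof -
  obtain f where f: "fractional_K_cover k G f"
    "\<And>g. fractional_K_cover k G g \<Longrightarrow> K_cover_weight k G f \<le> K_cover_weight k G g"
    using fractional_K_cover_minimum_exists[OF assms(1,2)] by blast
  then have "fractional_K_cover_number k G = K_cover_weight k G f"
    unfolding fractional_K_cover_number_def by (intro Least_equality) auto
  with f assms(3) show ?thesis by simp
qed

end

theory Submission
  imports Defs
begin

text \<open>
  Let \<open>c\<close> be an \<open>a:b\<close>-colouring. For a set \<open>T\<close> of \<open>m\<close> colours, let \<open>W T\<close> be the set of vertices
  with at least \<open>r\<close> colours in \<open>T\<close>. The colour sets of a clique are disjoint, so \<open>W T\<close> contains no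
  \<open>(k+1)\<close>-clique as soon as \<open>m < (k+1)r\<close>. By symmetry every vertex lies in the same number \<open>d\<close> of the
  sets \<open>W T\<close>, and giving each of them weight \<open>1/d\<close> yields a cover of weight \<open>binom(a,m)/d\<close>.
  Taking \<open>(m, r) = (k, 1)\<close> and \<open>(m, r) = ((k+1)b-1, b)\<close> gives the two bounds; the first one with
  \<open>k = 1\<close> is \<open>a/b\<close>.
\<close>

section \<open>Fractional covers from families of vertex sets\<close>

text \<open>Each index carries weight \<open>1/d\<close>; \<open>N H\<close> collects the weight of
  all indices that induce \<open>H\<close>. Every vertex then receives at least \<open>d/d\<close>,
  and the total is at most \<open>card I / d\<close>.\<close>

lemma fractional_K_cover_number_le_family:
  assumes "graph G" "k \<ge> 1" "finite I" "d > 0"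
    and W: "\<And>i. i \<in> I \<Longrightarrow> W i \<subseteq> verts G" "\<And>i. i \<in> I \<Longrightarrow> in_K k (G \<restriction> W i)"
    and cover: "\<And>v. v \<in> verts G \<Longrightarrow> d \<le> card {i \<in> I. v \<in> W i}"
  shows "fractional_K_cover_number k G \<le> real (card I) / real d"
proof -
  interpret graph G by fact
  define N where "N H = real (card {i \<in> I. G \<restriction> W i = H}) / real d" for H
  \<comment> \<open>Different indices may give the same subgraph, so the accumulated weight is capped at 1.\<close>
  define f where "f H = min 1 (N H)" for H
  have finK: "finite (K_subgraphs k G)" using assms(1) by (rule finite_K_subgraphs)
  have N_nonneg: "N H \<ge> 0" for H by (simp add: N_def)
  have mem: "G \<restriction> W i \<in> K_subgraphs k G" if "i \<in> I" "W i \<noteq> {}" for i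
    using that W induced_induce[OF W(1)] by (simp add: K_subgraphs_def)
  \<comment> \<open>Grouping indices by the subgraph they induce. Here \<open>J\<close> must be
    exactly the set of indices whose subgraph lies in \<open>K\<close>: first those with
    \<open>v\<close> in \<open>W i\<close>, later those with \<open>W i\<close> non-empty.\<close>
  have sum_N: "(\<Sum>H \<in> K. N H) = real (card J) / real d"
    if "finite K" "J \<subseteq> I" "(\<lambda>i. G \<restriction> W i) ` J \<subseteq> K"
      and J: "\<And>i. i \<in> I \<Longrightarrow> G \<restriction> W i \<in> K \<Longrightarrow> i \<in> J" for K J
  proof -
    have finJ: "finite J" using that(2) assms(3) by (rule finite_subset)
    have "(\<Sum>H \<in> K. card {i \<in> I. G \<restriction> W i = H}) = (\<Sum>H \<in> K. card {i \<in> J. G \<restriction> W i = H})"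
      using that(2) J by (intro sum.cong refl arg_cong[of _ _ card]) auto
    also have "\<dots> = card J"
      using sum.group[OF finJ that(1,3), of "\<lambda>_. 1 :: nat"] by simp
    finally show ?thesis
      unfolding N_def by (simp flip: sum_divide_distrib of_nat_sum)
  qed
  have "fractional_K_cover k G f"
    unfolding fractional_K_cover_def
  proof (intro conjI ballI)
    show "f \<in> K_subgraphs k G \<rightarrow> {0..1}"
      using N_nonneg by (auto simp: f_def)
  next
    fix v assume v: "v \<in> verts G"
    let ?K = "K_subgraphs_at k G v"
    have fin: "finite ?K"
      using finK by (rule finite_subset[rotated]) (auto simp: K_subgraphs_at_def)
    show "(\<Sum>H \<in> ?K. f H) \<ge> 1"
    \<comment> \<open>A subgraph whose weight reaches the cap covers \<open>v\<close> alone;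
      otherwise no cap is active at \<open>v\<close> and \<open>f\<close> agrees with
      \<open>N\<close> there.\<close>
    proof (cases "\<exists>H \<in> ?K. N H \<ge> 1")
      case True
      then obtain H where H: "H \<in> ?K" "f H = 1" by (auto simp: f_def)
      have "f H \<le> (\<Sum>H \<in> ?K. f H)"
        using fin H N_nonneg by (intro member_le_sum) (auto simp: f_def)
      with H show ?thesis by simp
    next
      case False
      then have "(\<Sum>H \<in> ?K. f H) = (\<Sum>H \<in> ?K. N H)"
        by (intro sum.cong) (auto simp: f_def)
      also have "\<dots> = real (card {i \<in> I. v \<in> W i}) / real d"
        using fin mem by (intro sum_N) (auto simp: K_subgraphs_at_def)
      finally show ?thesis
        using cover[OF v] \<open>d > 0\<close> by simp
    qed
  qed
  then have "fractional_K_cover_number k G \<le> K_cover_weight k G f"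
    using assms(1,2) by (intro fractional_K_cover_number_le)
  also have "\<dots> \<le> (\<Sum>H \<in> K_subgraphs k G. N H)"
    unfolding K_cover_weight_def by (intro sum_mono) (simp add: f_def)
  \<comment> \<open>Empty sets \<open>W i\<close> drop out, since members of
    \<open>K_subgraphs\<close> have a vertex.\<close>
  also have "\<dots> = real (card {i \<in> I. W i \<noteq> {}}) / real d"
    using finK mem by (intro sum_N) (auto simp: K_subgraphs_def)
  also have "\<dots> \<le> real (card I) / real d"
    using assms(3) by (intro divide_right_mono) (auto intro!: card_mono)
  finally show ?thesis .
qed

section \<open>Colour sets on cliques\<close>

text \<open>The colour sets of distinct clique vertices are disjoint, so their traces on
  \<open>T\<close>, each of size at least \<open>r\<close>, pack disjointly into
  \<open>T\<close>.\<close>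

lemma clique_colours_bound:
  fixes c :: "'a \<Rightarrow> 'c set"
  assumes H: "subgraph H G" "complete_digraph n H" and "finite T"
    and disj: "\<And>u v. u \<rightarrow>\<^bsub>G\<^esub> v \<Longrightarrow> c u \<inter> c v = {}"
    and r: "\<And>v. v \<in> verts H \<Longrightarrow> r \<le> card (c v \<inter> T)"
  shows "n * r \<le> card T"
proof -
  interpret H: graph H using H(2) by (simp add: complete_digraph_def)
  have "arcs_ends H \<subseteq> arcs_ends G"
    using H(1) by (auto simp: subgraph_def compatible_def arcs_ends_def arc_to_ends_def)
  then have "\<forall>u \<in> verts H. \<forall>v \<in> verts H. u \<noteq> v \<longrightarrow> (c u \<inter> T) \<inter> (c v \<inter> T) = {}"
    using H(2) disj by (fastforce simp: complete_digraph_def)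
  then have "(\<Sum>v \<in> verts H. card (c v \<inter> T)) = card (\<Union>v \<in> verts H. c v \<inter> T)"
    using \<open>finite T\<close> by (subst card_UN_disjoint) auto
  also have "\<dots> \<le> card T"
    using \<open>finite T\<close> by (intro card_mono) auto
  moreover have "n * r \<le> (\<Sum>v \<in> verts H. card (c v \<inter> T))"
    using H(2) sum_bounded_below[of "verts H" r "\<lambda>v. card (c v \<inter> T)"] r
    by (auto simp: complete_digraph_def)
  ultimately show ?thesis by linarith
qed

lemma fractional_K_cover_number_le_colour_subsets:
  fixes G :: "('a, 'b) pre_digraph"
  assumes "graph G" "k \<ge> 1" "ab_colourable a b G" "m < (k + 1) * r" "d > 0"
    and d: "\<And>S. S \<subseteq> {..<a} \<Longrightarrow> card S = b \<Longrightarrow>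
      d \<le> card {T. T \<subseteq> {..<a} \<and> card T = m \<and> r \<le> card (S \<inter> T)}"
  shows "fractional_K_cover_number k G \<le> real (a choose m) / real d"
proof -
  obtain c :: "'a \<Rightarrow> nat set" where
    c: "\<And>v. v \<in> verts G \<Longrightarrow> c v \<subseteq> {..<a} \<and> card (c v) = b"
    and disj: "\<And>u v. u \<rightarrow>\<^bsub>G\<^esub> v \<Longrightarrow> c u \<inter> c v = {}"
    using assms(3) unfolding ab_colourable_def by blast
  define I where "I = {T. T \<subseteq> {..<a} \<and> card T = m}"
  define W where "W T = {v \<in> verts G. r \<le> card (c v \<inter> T)}" for T
  have "in_K k (G \<restriction> W T)" if T: "T \<in> I" for T
    unfolding in_K_def contains_clique_def
  proof
    assume "\<exists>H. subgraph H (G \<restriction> W T) \<and> complete_digraph (k + 1) H"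
    then obtain H where H: "subgraph H (G \<restriction> W T)" "complete_digraph (k + 1) H" by blast
    have "finite T" using T by (auto simp: I_def intro: finite_subset)
    moreover have "c u \<inter> c v = {}" if "u \<rightarrow>\<^bsub>G \<restriction> W T\<^esub> v" for u v
      using that by (intro disj) (auto dest: dominates_induce_subgraphD)
    moreover have "r \<le> card (c v \<inter> T)" if "v \<in> verts H" for v
      using that H(1) by (auto simp: subgraph_def W_def)
    ultimately have "(k + 1) * r \<le> card T" using H by (intro clique_colours_bound)
    then show False using T assms(4) by (simp add: I_def)
  qed
  \<comment> \<open>Membership of \<open>v\<close> in \<open>W T\<close> depends only on its colour
    set, so the count for \<open>S = c v\<close> applies.\<close>
  moreover have "d \<le> card {T \<in> I. v \<in> W T}" if "v \<in> verts G" for v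
    using d[of "c v"] c[OF that] that by (simp add: I_def W_def)
  moreover have "finite I" by (simp add: I_def)
  ultimately have "fractional_K_cover_number k G \<le> real (card I) / real d"
    using assms(1,2,5) by (intro fractional_K_cover_number_le_family[where W = W]) (auto simp: W_def)
  then show ?thesis by (simp add: I_def n_subsets)
qed

section \<open>Counting subsets and comparing binomials\<close>

lemma card_subsets_meeting:
  assumes "finite A" "S \<subseteq> A"
  shows "card {T. T \<subseteq> A \<and> card T = k \<and> 1 \<le> card (S \<inter> T)}
    = (card A choose k) - (card A - card S choose k)"
proof -
  have "{T. T \<subseteq> A \<and> card T = k \<and> 1 \<le> card (S \<inter> T)}
      = {T. T \<subseteq> A \<and> card T = k} - {T. T \<subseteq> A - S \<and> card T = k}"
    using assms finite_subset[OF assms(2,1)] by (auto simp: Suc_le_eq card_gt_0_iff)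
  then have "card {T. T \<subseteq> A \<and> card T = k \<and> 1 \<le> card (S \<inter> T)}
      = card {T. T \<subseteq> A \<and> card T = k} - card {T. T \<subseteq> A - S \<and> card T = k}"
    using assms(1) by (simp only:) (rule card_Diff_subset; auto)
  then show ?thesis
    using assms by (simp add: n_subsets card_Diff_subset finite_subset)
qed

text \<open>The intersection condition forces \<open>S\<close> to lie inside \<open>T\<close>, and
  deleting \<open>S\<close> is then a bijection. For \<open>card S > m\<close> truncated subtraction
  would give 1 on the right instead of 0.\<close>

lemma card_subsets_containing:
  assumes "finite A" "S \<subseteq> A" "card S \<le> m"
  shows "card {T. T \<subseteq> A \<and> card T = m \<and> card S \<le> card (S \<inter> T)}
    = (card A - card S) choose (m - card S)"
proof -
  have finS: "finite S" using assms by (auto intro: finite_subset)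
  have "card S \<le> card (S \<inter> T) \<longleftrightarrow> S \<subseteq> T" for T
    using finS card_seteq[of S "S \<inter> T"] by (auto simp: Int_absorb2)
  moreover have "bij_betw (\<lambda>T. T - S) {T. T \<subseteq> A \<and> card T = m \<and> S \<subseteq> T}
      {U. U \<subseteq> A - S \<and> card U = m - card S}"
  proof (rule bij_betw_byWitness[where f' = "\<lambda>U. U \<union> S"])
    show "(\<lambda>T. T - S) ` {T. T \<subseteq> A \<and> card T = m \<and> S \<subseteq> T} \<subseteq> {U. U \<subseteq> A - S \<and> card U = m - card S}"
      using finS by (auto simp: card_Diff_subset)
    have "card (U \<union> S) = m" if "U \<subseteq> A - S" "card U = m - card S" for U
      using that assms finS by (subst card_Un_disjoint) (auto intro: finite_subset)
    then show "(\<lambda>U. U \<union> S) ` {U. U \<subseteq> A - S \<and> card U = m - card S}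
        \<subseteq> {T. T \<subseteq> A \<and> card T = m \<and> S \<subseteq> T}"
      using assms(2) by auto
  qed auto
  ultimately show ?thesis
    using assms finS by (simp add: bij_betw_same_card n_subsets card_Diff_subset)
qed

text \<open>Strictness comes from the positive second term of Pascal's rule; it later keeps the
  denominators positive.\<close>

lemma binomial_less_right:
  assumes "m < n" "0 < k" "k \<le> n"
  shows "m choose k < n choose k"
proof -
  obtain n' k' where eq: "n = Suc n'" "k = Suc k'"
    using assms by (metis gr0_conv_Suc less_imp_Suc_add)
  have "m choose k \<le> n' choose k" using assms(1) eq by (intro binomial_right_mono) simp
  moreover have "n' choose k' > 0" using assms(3) eq by (simp add: zero_less_binomial)
  ultimately show ?thesis unfolding eq binomial_Suc_Suc by linarith
qed

text \<open>Both sides count pairs of disjoint subsets of sizes \<open>k\<close> and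
  \<open>j\<close> in an \<open>n\<close>-set. It serves to exchange \<open>k\<close> and
  \<open>b\<close> in the meeting bound.\<close>

lemma choose_commute_complement:
  assumes "k \<le> n" "j \<le> n"
  shows "(n choose k) * (n - k choose j) = (n choose j) * (n - j choose k)"
proof (cases "k + j \<le> n")
  case True
  then show ?thesis
    using choose_mult[of k "k + j" n] choose_mult[of j "k + j" n]
      binomial_symmetric[of k "k + j"] by simp
qed (use assms in \<open>simp add: binomial_eq_0\<close>)

section \<open>The two covers obtained from colour subsets\<close>

lemma fractional_K_cover_number_le_meeting:
  assumes "graph G" "ab_colourable a b G" "k \<ge> 1" "k \<le> a" "b > 0" "b \<le> a"
  shows "fractional_K_cover_number k G
    \<le> real (a choose k) / real ((a choose k) - (a - b choose k))"
proof -
  have "a - b choose k < a choose k"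
    using assms by (intro binomial_less_right) auto
  moreover have "card {T. T \<subseteq> {..<a} \<and> card T = k \<and> 1 \<le> card (S \<inter> T)}
      = (a choose k) - (a - b choose k)" if "S \<subseteq> {..<a}" "card S = b" for S
    using card_subsets_meeting[OF finite_lessThan that(1)] that(2) by simp
  ultimately show ?thesis
    using assms by (intro fractional_K_cover_number_le_colour_subsets[where r = 1 and b = b]) simp_all
qed

lemma fractional_K_cover_number_le_containing:
  assumes "graph G" "ab_colourable a b G" "k \<ge> 1" "b > 0" "b \<le> m" "m \<le> a" "m < (k + 1) * b"
  shows "fractional_K_cover_number k G
    \<le> real (a choose m) / real (a - b choose (m - b))"
proof -
  have "card {T. T \<subseteq> {..<a} \<and> card T = m \<and> b \<le> card (S \<inter> T)} = a - b choose (m - b)"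
    if "S \<subseteq> {..<a}" "card S = b" for S
    using card_subsets_containing[OF finite_lessThan that(1), of m] that(2) assms(5) by simp
  then show ?thesis
    using assms
    by (intro fractional_K_cover_number_le_colour_subsets[where r = b and b = b]) simp_all
qed

section \<open>The clique number\<close>

lemma graph_induce_subgraph:
  assumes "graph G" "S \<subseteq> verts G"
  shows "graph (G \<restriction> S)"
proof -
  interpret graph G by fact
  have ind: "induced_subgraph (G \<restriction> S) G" using assms(2) by (rule induced_induce)
  have "digraph (G \<restriction> S)" using ind by (rule digraphI_induced)
  moreover have "sym_digraph (G \<restriction> S)" using ind by (rule induced_graph_imp_graph)
  ultimately show ?thesis
    by (simp add: graph_def pseudo_graph_def digraph_def)
qed

lemma clique_number_attained:
  assumes "graph G"
  obtains H where "induced_subgraph H G" "complete_digraph (clique_number G) H"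
proof -
  interpret graph G by fact
  let ?C = "{card (verts H) | H. induced_subgraph H G \<and> complete_digraph (card (verts H)) H}"
  have "finite ?C"
    by (rule finite_surj[OF finite_induced_subgraphs[OF assms], of _ "\<lambda>H. card (verts H)"]) auto
  \<comment> \<open>The empty subgraph is complete on 0 vertices, so the set under
    \<open>Max\<close> is non-empty even for the null graph.\<close>
  moreover have "induced_subgraph (G \<restriction> {}) G" by auto
  moreover have "complete_digraph (card (verts (G \<restriction> {}))) (G \<restriction> {})"
    using graph_induce_subgraph[OF assms, of "{}"]
    by (auto simp: complete_digraph_def arcs_ends_def)
  ultimately have "Max ?C \<in> ?C" by (intro Max_in) blast+
  then show ?thesis using that by (auto simp: clique_number_def)
qed

text \<open>Bridges \<open>contains_clique\<close>, which allows arbitrary subgraphs, and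
  \<open>clique_number\<close>, which uses induced ones: without loops and parallel arcs, a complete
  subgraph is already induced.\<close>

lemma complete_subgraph_le_clique_number:
  assumes "graph G" "subgraph H G" "complete_digraph n H"
  shows "n \<le> clique_number G"
proof -
  interpret graph G by fact
  have n: "n = card (verts H)" using assms(3) by (simp add: complete_digraph_def)
  have "e \<in> arcs H" if e: "e \<in> arcs G" "tail G e \<in> verts H" "head G e \<in> verts H" for e
  proof -
    have "arc_to_ends G e \<in> arcs_ends H"
      using e no_loops[OF e(1)] assms(3) by (simp add: complete_digraph_def arc_to_ends_def)
    then obtain e' where e': "e' \<in> arcs H" "arc_to_ends G e = arc_to_ends H e'"
      by (auto simp: arcs_ends_def)
    then have "e' \<in> arcs G" "arc_to_ends G e = arc_to_ends G e'"
      using assms(2) by (auto simp: subgraph_def compatible_def arc_to_ends_def)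
    then show ?thesis using no_multi_arcs e(1) e'(1) by metis
  qed
  then have "induced_subgraph H G"
    using assms(2) wf_digraph.wellformed[of H]
    by (auto simp: induced_subgraph_def subgraph_def compatible_def)
  moreover have "finite {card (verts H) | H. induced_subgraph H G \<and> complete_digraph (card (verts H)) H}"
    by (rule finite_surj[OF finite_induced_subgraphs[OF assms(1)], of _ "\<lambda>H. card (verts H)"]) auto
  ultimately show ?thesis
    using assms(3) unfolding n clique_number_def by (intro Max_ge) auto
qed

lemma clique_number_ge_1:
  assumes "graph G" "verts G \<noteq> {}"
  shows "clique_number G \<ge> 1"
proof -
  interpret graph G by fact
  obtain v where v: "v \<in> verts G" using assms(2) by blast
  then have ind: "induced_subgraph (G \<restriction> {v}) G" by auto
  have "complete_digraph 1 (G \<restriction> {v})"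
    using graph_induce_subgraph[OF assms(1), of "{v}"] v
    by (auto simp: complete_digraph_def arcs_ends_def arc_to_ends_def dest: no_loops)
  then show ?thesis
    using ind assms(1) by (intro complete_subgraph_le_clique_number) auto
qed

text \<open>A maximum clique uses \<open>b\<close> fresh colours per vertex: the packing bound with
  \<open>T\<close> the whole palette and \<open>r = b\<close>.\<close>

lemma clique_number_mult_le:
  fixes G :: "('a, 'b) pre_digraph"
  assumes "graph G" "ab_colourable a b G"
  shows "clique_number G * b \<le> a"
proof -
  obtain c :: "'a \<Rightarrow> nat set" where
    c: "\<And>v. v \<in> verts G \<Longrightarrow> c v \<subseteq> {..<a} \<and> card (c v) = b"
    and disj: "\<And>u v. u \<rightarrow>\<^bsub>G\<^esub> v \<Longrightarrow> c u \<inter> c v = {}"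
    using assms(2) unfolding ab_colourable_def by blast
  obtain H where H: "induced_subgraph H G" "complete_digraph (clique_number G) H"
    using clique_number_attained[OF assms(1)] .
  then have sub: "subgraph H G" by auto
  have "b \<le> card (c v \<inter> {..<a})" if "v \<in> verts H" for v
    using c[of v] that sub by (auto simp: subgraph_def Int_absorb2)
  from clique_colours_bound[OF sub H(2) finite_lessThan disj this] show ?thesis by simp
qed

text \<open>\<open>G\<close> itself is an admissible subgraph and covers with weight 1; conversely,
  the subgraphs through any one vertex already have total weight at least 1.\<close>

lemma fractional_K_cover_number_clique_number:
  assumes "graph G" "verts G \<noteq> {}"
  shows "fractional_K_cover_number (clique_number G) G = 1"
proof (rule antisym)
  interpret graph G by fact
  let ?w = "clique_number G"
  have w: "?w \<ge> 1" using assms by (rule clique_number_ge_1)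
  have whole: "G \<restriction> verts G = G"
    by (auto simp: induce_subgraph_def intro!: pre_digraph.equality)
  have "in_K ?w G"
    using complete_subgraph_le_clique_number[OF assms(1), of _ "?w + 1"]
    by (auto simp: in_K_def contains_clique_def)
  then show "fractional_K_cover_number ?w G \<le> 1"
    using fractional_K_cover_number_le_family[of G ?w "{()}" 1 "\<lambda>_. verts G"] assms w
    by (simp add: whole)
  obtain f where f: "fractional_K_cover ?w G f" "K_cover_weight ?w G f = fractional_K_cover_number ?w G"
    using fractional_K_cover_number_attained[OF assms(1) w] .
  obtain v where "v \<in> verts G" using assms(2) by blast
  then have "1 \<le> (\<Sum>H \<in> K_subgraphs_at ?w G v. f H)"
    using f(1) by (simp add: fractional_K_cover_def)
  also have "\<dots> \<le> K_cover_weight ?w G f"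
    unfolding K_cover_weight_def using f(1) finite_K_subgraphs[OF assms(1)]
    by (intro sum_mono2) (auto simp: fractional_K_cover_def K_subgraphs_at_def Pi_iff)
  finally show "1 \<le> fractional_K_cover_number ?w G" using f(2) by simp
qed

section \<open>Combining the bounds\<close>

theorem theorem3p10:
  fixes a b :: nat and G :: "('a, 'b) pre_digraph"
  assumes "a > 0" and "b > 0" and "a \<ge> 2 * b"
    and "graph G" and "verts G \<noteq> {}"
    and "ab_colourable a b G"
  shows "fractional_K_cover_number 1 G \<le> real a / real b \<and>
    (\<forall>k. 1 < k \<and> k < clique_number G \<longrightarrow>
      fractional_K_cover_number k G \<le>
        real (a choose b) /
          max (real (((k + 1) * b - 1) choose b))
              (real (a choose b) - real ((a - k) choose b))) \<and>
    fractional_K_cover_number (clique_number G) G = 1"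
proof (intro conjI allI impI)
  have "b \<le> a" using assms(3) by simp
  show "fractional_K_cover_number 1 G \<le> real a / real b"
    using fractional_K_cover_number_le_meeting[of G a b 1] assms by simp
  show "fractional_K_cover_number (clique_number G) G = 1"
    using assms(4,5) by (rule fractional_K_cover_number_clique_number)
  fix k assume k: "1 < k \<and> k < clique_number G"
  \<comment> \<open>The largest size below \<open>(k + 1) * b\<close>, hence the largest allowed for
    threshold \<open>r = b\<close>.\<close>
  define m where "m = (k + 1) * b - 1"
  have "(k + 1) * b \<le> clique_number G * b" using k by (intro mult_right_mono) auto
  also have "\<dots> \<le> a" using assms(4,6) by (rule clique_number_mult_le)
  finally have kb: "(k + 1) * b \<le> a" .
  have "k * 1 \<le> (k + 1) * b" using assms(2) by (intro mult_le_mono) auto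
  with kb have "k \<le> a" by (metis le_trans mult.right_neutral)
  have "b \<le> k * b" using k by simp
  moreover have "(k + 1) * b = k * b + b" by simp
  ultimately have m: "b \<le> m" "m \<le> a" "m < (k + 1) * b"
    using kb assms(2) unfolding m_def by linarith+
  have pos: "a choose b > 0" "m choose b > 0" "a - b choose (m - b) > 0"
    using \<open>b \<le> a\<close> m by auto
  have "fractional_K_cover_number k G \<le> real (a choose m) / real (a - b choose (m - b))"
    using m k assms by (intro fractional_K_cover_number_le_containing) auto
  \<comment> \<open>Double counting of pairs of a \<open>b\<close>-set inside an
    \<open>m\<close>-set of colours.\<close>
  also have "\<dots> = real (a choose b) / real (m choose b)"
    using choose_mult[OF m(1,2)] pos by (simp add: frac_eq_eq flip: of_nat_mult)
  finally have 1: "fractional_K_cover_number k G \<le> real (a choose b) / real (m choose b)" .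
  have lt: "a - b choose k < a choose k" "a - k choose b < a choose b"
    using assms(2) k \<open>k \<le> a\<close> \<open>b \<le> a\<close> by (auto intro!: binomial_less_right)
  have "fractional_K_cover_number k G \<le> real (a choose k) / real ((a choose k) - (a - b choose k))"
    using \<open>k \<le> a\<close> \<open>b \<le> a\<close> k assms by (intro fractional_K_cover_number_le_meeting) auto
  \<comment> \<open>After cross-multiplication the products of full binomials cancel, leaving
    \<open>choose_commute_complement\<close>; \<open>lt\<close> makes both denominators positive and
    the natural subtraction exact.\<close>
  also have "\<dots> = real (a choose b) / (real (a choose b) - real (a - k choose b))"
  proof -
    have "real (a choose k) * real (a - k choose b) = real (a choose b) * real (a - b choose k)"
      using choose_commute_complement[OF \<open>k \<le> a\<close> \<open>b \<le> a\<close>] by (simp flip: of_nat_mult)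
    then show ?thesis using lt by (simp add: of_nat_diff frac_eq_eq algebra_simps)
  qed
  finally have 2: "fractional_K_cover_number k G
    \<le> real (a choose b) / (real (a choose b) - real (a - k choose b))" .
  show "fractional_K_cover_number k G \<le>
      real (a choose b) /
        max (real (((k + 1) * b - 1) choose b))
            (real (a choose b) - real ((a - k) choose b))"
    \<comment> \<open>The larger denominator gives the smaller of the two bounds.\<close>
    using 1 2 by (simp add: max_def m_def)
qed

end
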